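(* Let $r\geq 0$, $s>0$ and $n>0$ be integers. Let $\chi_1,\ldots,\chi_s$ be Dirichlet characters modulo $n$ with conductors $d_1,\ldots,d_s$ respectively, and let $d=\mathrm{lcm}(d_1,\ldots,d_s)$. Let $n_0\mid n$ be the greatest divisor of $n$ such that $n_0$ and $d$ have the same prime factors. Then \[ \sum_{\substack{a_1,\ldots,a_s\in\mathbb{Z}_n^\ast\\ b_1,\ldots,b_r\in\mathbb{Z}_n}}\gcd(a_1-1,\ldots,a_s-1,b_1,\ldots,b_r,n)\,\chi_1(a_1)\cdots\chi_s(a_s) =\varphi(n)\,\sigma_{s+r-1}\!\left(\frac{n_0}{d}\right)\prod_{p^m\,\|\,n/n_0}\left(\varphi(p^m)^{s-1}p^{mr}+\sigma_{s+r-1}(p^m)-p^{m(s+r-1)}\right), \] where the product runs over the primes $p$ dividing $n/n_0$ and $p^m\,\|\,n/n_0$ means $p^m$ exactly divides $n/n_0$.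
   Context: $\mathbb{Z}_n=\mathbb{Z}/n\mathbb{Z}$ and $\mathbb{Z}_n^\ast$ is its group of units; the gcd is computed using any integer representatives (it is well defined since $n$ is among the arguments). $\varphi$ is Euler's totient function and $\sigma_k(N)=\sum_{e\mid N}e^k$ is the divisor function. *)

theory Defs
  imports Complex_Main "HOL-Number_Theory.Number_Theory" "HOL-Library.FuncSet"
begin

text \<open>The rings \<open>\<int>/n\<int>\<close> and their unit groups are represented by the least nonnegative
  residues. In particular, for \<open>n = 1\<close> both sets are \<open>{0}\<close>.\<close>

definition residues_mod :: "nat \<Rightarrow> int set" where
  "residues_mod n = {0..<int n}"

definition unit_residues_mod :: "nat \<Rightarrow> int set" where
  "unit_residues_mod n = {a \<in> residues_mod n. coprime a (int n)}"

text \<open>A Dirichlet character is taken as a function on all integers, extended by \<open>0\<close> to the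
  integers not coprime to the modulus. The property \<open>\<chi> 1 = 1\<close> follows from the conditions
  below.\<close>

definition dirichlet_character :: "nat \<Rightarrow> (int \<Rightarrow> complex) \<Rightarrow> bool" where
  "dirichlet_character n \<chi> \<longleftrightarrow>
     (\<forall>a. \<chi> (a + int n) = \<chi> a) \<and>
     (\<forall>a b. \<chi> (a * b) = \<chi> a * \<chi> b) \<and>
     (\<forall>a. \<chi> a \<noteq> 0 \<longleftrightarrow> coprime a (int n))"

text \<open>The conductor is the least divisor \<open>d\<close> of \<open>n\<close> such that \<open>\<chi>\<close>, as a character of the unit
  group modulo \<open>n\<close>, factors through the unit group modulo \<open>d\<close>. For \<open>n > 0\<close> it exists,
  because \<open>d = n\<close> qualifies.\<close>

definition conductor :: "nat \<Rightarrow> (int \<Rightarrow> complex) \<Rightarrow> nat" where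
  "conductor n \<chi> = (LEAST d. d dvd n \<and>
     (\<exists>\<psi>. dirichlet_character d \<psi> \<and> (\<forall>a. coprime a (int n) \<longrightarrow> \<chi> a = \<psi> a)))"

definition divisor_sigma :: "nat \<Rightarrow> nat \<Rightarrow> nat" where
  "divisor_sigma k N = (\<Sum>e | e dvd N. e ^ k)"

end

theory Submission
  imports Defs
begin

text \<open>Since \<open>g = (\<Sum>e | e dvd g. totient e)\<close>, the sum splits over the divisors \<open>e\<close> of \<open>n\<close>: the
  variables \<open>b\<^sub>j\<close> contribute \<open>(n / e) ^ r\<close>, and each \<open>a\<^sub>i\<close> contributes the sum of \<open>\<chi>\<^sub>i\<close> over the kernel
  of reduction from units modulo \<open>n\<close> to units modulo \<open>e\<close>. By orthogonality the latter is
  \<open>totient n / totient e\<close> if the conductor of \<open>\<chi>\<^sub>i\<close> divides \<open>e\<close>, and \<open>0\<close> otherwise. What remains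
  is \<open>totient n\<close> times the sum of \<open>(n / e) ^ r * (totient n / totient e) ^ (s - 1)\<close> over the \<open>e\<close> with
  \<open>d dvd e\<close> and \<open>e dvd n\<close>. It factors along the coprime decomposition \<open>n = n\<^sub>0 * (n div n\<^sub>0)\<close>. On the first
  factor \<open>totient n\<^sub>0 / totient e = n\<^sub>0 / e\<close>, because \<open>e\<close> and \<open>n\<^sub>0\<close> have the same primes; the second
  one is multiplicative and is evaluated at prime powers.\<close>

section \<open>Units modulo \<open>n\<close> and their reduction modulo a divisor\<close>

lemma finite_unit_residues_mod [simp]: "finite (unit_residues_mod n)"
  by (rule finite_subset [of _ "{0..<int n}"]) (auto simp: unit_residues_mod_def residues_mod_def)

lemma unit_residues_mod_iff:
  "a \<in> unit_residues_mod n \<longleftrightarrow> 0 \<le> a \<and> a < int n \<and> coprime a (int n)"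
  by (auto simp: unit_residues_mod_def residues_mod_def)

lemma card_unit_residues_mod:
  assumes "n > 0"
  shows "card (unit_residues_mod n) = totient n"
\<comment> \<open>For \<open>n = 1\<close> the only residue is \<open>0\<close>, whereas
  \<open>totatives 1 = {1}\<close>; for larger \<open>n\<close> the two sets agree.\<close>
proof (cases "n = 1")
  case True
  then have "unit_residues_mod n = {0}"
    by (auto simp: unit_residues_mod_iff)
  then show ?thesis using True by simp
next
  case False
  then have n: "n > 1" using assms by simp
  have "unit_residues_mod n = int ` totatives n"
  proof safe
    fix a assume a: "a \<in> unit_residues_mod n"
    then have "a \<noteq> 0" using n by (auto simp: unit_residues_mod_iff)
    with a have "nat a \<in> totatives n"
      by (auto simp: unit_residues_mod_iff in_totatives_iff coprime_int_iff [symmetric])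
    moreover have "a = int (nat a)" using a by (simp add: unit_residues_mod_iff)
    ultimately show "a \<in> int ` totatives n" by blast
  next
    fix k assume k: "k \<in> totatives n"
    then show "int k \<in> unit_residues_mod n"
      using totatives_less [OF k n] by (auto simp: unit_residues_mod_iff in_totatives_iff)
  qed
  then show ?thesis
    by (simp add: card_image totient_def)
qed

lemma unit_residues_mod_mod:
  assumes "n > 0" "coprime a (int n)"
  shows "a mod int n \<in> unit_residues_mod n"
  using assms by (simp add: unit_residues_mod_iff)

text \<open>Shift \<open>b\<close> by \<open>l * t\<close>, where \<open>t\<close> collects the
  primes of \<open>n\<close> not dividing \<open>b\<close>: every prime of \<open>n\<close> then
  divides exactly one of \<open>b\<close> and \<open>l * t\<close>. The modulus \<open>l\<close> is
  kept independent of \<open>n\<close> because a later application takes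
  \<open>l = e * f\<close>.\<close>

lemma lift_unit:
  fixes b :: int
  assumes "n > 0" "coprime b (int l)"
  obtains c where "[c = b] (mod int l)" "coprime c (int n)"
proof -
  define t where "t = \<Prod>{p \<in> prime_factors (int n). \<not> p dvd b}"
  have "coprime (b + int l * t) (int n)"
  proof (rule ccontr)
    assume "\<not> coprime (b + int l * t) (int n)"
    then obtain p where p: "prime p" "p dvd b + int l * t" "p dvd int n"
      using prime_divisor_exists [of "gcd (b + int l * t) (int n)"] assms(1)
      by (auto simp: coprime_iff_gcd_eq_1 is_unit_gcd_iff)
    show False
    proof (cases "p dvd b")
      case True
      then have "p dvd int l * t" using p(2) by (simp add: dvd_add_right_iff)
      then have "p dvd int l \<or> p dvd t" using p(1) by (simp add: prime_dvd_mult_iff)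
      moreover have "\<not> p dvd int l"
        using True assms(2) p(1) by (meson coprime_common_divisor not_prime_unit)
      moreover have "\<not> p dvd t"
      proof
        assume "p dvd t"
        then obtain q where "q \<in> prime_factors (int n)" "\<not> q dvd b" "p dvd q"
          unfolding t_def using p(1) by (subst (asm) prime_dvd_prod_iff) auto
        then show False using p(1) True
          by (metis in_prime_factors_iff primes_dvd_imp_eq)
      qed
      ultimately show False by blast
    next
      case False
      then have "p \<in> {p \<in> prime_factors (int n). \<not> p dvd b}"
        using p assms(1) by (auto simp: in_prime_factors_iff)
      then have "p dvd t"
        unfolding t_def by (intro dvd_prodI) auto
      then show False using False p(2) by (simp add: dvd_add_left_iff)
    qed
  qed
  moreover have "[b + int l * t = b] (mod int l)"
    by (simp add: cong_def)
  ultimately show thesis using that by blast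
qed

text \<open>Multiplication by an inverse \<open>v\<close> of \<open>u\<close> modulo
  \<open>n\<close> is the inverse map, and congruences modulo \<open>e\<close> survive reduction
  modulo \<open>n\<close> since \<open>e dvd n\<close>. This serves both to compare fibres and to
  translate character sums.\<close>

lemma bij_betw_mult_unit:
  fixes u c :: int
  assumes n: "n > 0" and e: "e dvd n" and u: "coprime u (int n)"
  shows "bij_betw (\<lambda>a. u * a mod int n) {a \<in> unit_residues_mod n. [a = c] (mod int e)}
           {a \<in> unit_residues_mod n. [a = u * c] (mod int e)}"
proof -
  obtain v where v: "[u * v = 1] (mod int n)"
    using u cong_solve_coprime_int by blast
  have v': "[v * u = 1] (mod int n)" using v by (simp add: mult.commute)
  have cv: "coprime v (int n)"
    using v by (metis cong_imp_coprime cong_sym coprime_1_left coprime_mult_left_iff)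
  have en: "int e dvd int n" using e by simp
  have mm: "[x mod int n = x] (mod int e)" for x
    using en by (simp add: cong_def mod_mod_cancel)
  have inv: "y * (x * a mod int n) mod int n = a"
    if "[y * x = 1] (mod int n)" "a \<in> unit_residues_mod n" for x y a
  proof -
    have "y * (x * a mod int n) mod int n = (y * x) * a mod int n"
      by (simp add: mod_mult_right_eq mult.assoc)
    also have "\<dots> = 1 * a mod int n"
      using that(1) by (metis cong_def cong_scalar_right)
    also have "\<dots> = a" using that(2) by (simp add: unit_residues_mod_iff)
    finally show ?thesis .
  qed
  have ve: "[v * u = 1] (mod int e)"
    using v' en cong_dvd_modulus by blast
  show ?thesis
  proof (rule bij_betwI [where g = "\<lambda>a. v * a mod int n"])
    show "(\<lambda>a. u * a mod int n) \<in> {a \<in> unit_residues_mod n. [a = c] (mod int e)} \<rightarrow>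
        {a \<in> unit_residues_mod n. [a = u * c] (mod int e)}"
    proof safe
      fix a assume "a \<in> unit_residues_mod n"
      then show "u * a mod int n \<in> unit_residues_mod n"
        using u n by (intro unit_residues_mod_mod) (auto simp: unit_residues_mod_iff)
    next
      fix a assume "[a = c] (mod int e)"
      then show "[u * a mod int n = u * c] (mod int e)"
        using mm cong_trans cong_scalar_left by blast
    qed
    show "(\<lambda>a. v * a mod int n) \<in> {a \<in> unit_residues_mod n. [a = u * c] (mod int e)} \<rightarrow>
        {a \<in> unit_residues_mod n. [a = c] (mod int e)}"
    proof safe
      fix a assume "a \<in> unit_residues_mod n"
      then show "v * a mod int n \<in> unit_residues_mod n"
        using cv n by (intro unit_residues_mod_mod) (auto simp: unit_residues_mod_iff)
    next
      fix a assume "[a = u * c] (mod int e)"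
      then have "[v * a = v * u * c] (mod int e)"
        by (metis cong_scalar_left mult.assoc)
      also have "[v * u * c = c] (mod int e)"
        using ve by (metis cong_scalar_right mult_1)
      finally show "[v * a mod int n = c] (mod int e)"
        using mm cong_trans by blast
    qed
  qed (use inv [OF v] inv [OF v'] in auto)
qed

text \<open>The fibres of reduction to units modulo \<open>e\<close> are cosets of the kernel: a
  unit lift of \<open>c\<close> carries the fibre over \<open>1\<close> onto the fibre over
  \<open>c\<close>, so all have equal size.\<close>

lemma card_units_cong_1:
  assumes n: "n > 0" and e: "e dvd n"
  shows "totient e * card {a \<in> unit_residues_mod n. [a = 1] (mod int e)} = totient n"
proof -
  have e0: "e > 0" using n e by (metis dvd_pos_nat)
  define A where "A c = {a \<in> unit_residues_mod n. [a = c] (mod int e)}" for c :: int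
  have cardA: "card (A c) = card (A 1)" if c: "c \<in> unit_residues_mod e" for c
  proof -
    obtain u where u: "[u = c] (mod int e)" "coprime u (int n)"
      using lift_unit [OF n, of c e] c by (auto simp: unit_residues_mod_iff)
    have "card (A 1) = card (A (u * 1))"
      unfolding A_def by (rule bij_betw_same_card [OF bij_betw_mult_unit [OF n e u(2)]])
    also have "A (u * 1) = A c"
      using u(1) by (auto simp: A_def cong_def)
    finally show ?thesis by simp
  qed
  have "unit_residues_mod n = (\<Union>c \<in> unit_residues_mod e. A c)"
  proof (intro equalityI subsetI)
    fix a assume a: "a \<in> unit_residues_mod n"
    then have "coprime a (int e)"
      using e by (metis coprime_divisors dvd_refl of_nat_dvd_iff unit_residues_mod_iff)
    then have "a mod int e \<in> unit_residues_mod e"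
      by (rule unit_residues_mod_mod [OF e0])
    moreover have "a \<in> A (a mod int e)" using a by (simp add: A_def cong_def)
    ultimately show "a \<in> (\<Union>c \<in> unit_residues_mod e. A c)" by blast
  qed (auto simp: A_def)
  then have "totient n = card (\<Union>c \<in> unit_residues_mod e. A c)"
    using card_unit_residues_mod [OF n] by simp
  also have "\<dots> = (\<Sum>c \<in> unit_residues_mod e. card (A c))"
  proof (rule card_UN_disjoint)
    show "\<forall>c\<in>unit_residues_mod e. \<forall>c'\<in>unit_residues_mod e. c \<noteq> c' \<longrightarrow> A c \<inter> A c' = {}"
      by (auto simp: A_def cong_def unit_residues_mod_iff)
  qed (auto simp: A_def)
  also have "\<dots> = (\<Sum>c \<in> unit_residues_mod e. card (A 1))"
    by (rule sum.cong) (auto simp: cardA)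
  finally show ?thesis
    by (simp add: card_unit_residues_mod [OF e0] A_def)
qed

section \<open>Dirichlet characters, conductors and orthogonality\<close>

lemma dirichlet_character_mult: "dirichlet_character n \<chi> \<Longrightarrow> \<chi> (a * b) = \<chi> a * \<chi> b"
  by (simp add: dirichlet_character_def)

lemma dirichlet_character_eq_0_iff:
  "dirichlet_character n \<chi> \<Longrightarrow> \<chi> a = 0 \<longleftrightarrow> \<not> coprime a (int n)"
  unfolding dirichlet_character_def by blast

lemma dirichlet_character_1:
  assumes "dirichlet_character n \<chi>"
  shows "\<chi> 1 = 1"
  using dirichlet_character_mult [OF assms, of 1 1] dirichlet_character_eq_0_iff [OF assms, of 1]
  by simp

lemma dirichlet_character_cong:
  assumes \<chi>: "dirichlet_character n \<chi>" and ab: "[a = b] (mod int n)"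
  shows "\<chi> a = \<chi> b"
proof -
  have plus: "\<chi> (x + int k * int n) = \<chi> x" for x k
  proof (induction k)
    case (Suc k)
    have "\<chi> (x + int (Suc k) * int n) = \<chi> ((x + int k * int n) + int n)"
      by (simp add: algebra_simps)
    also have "\<dots> = \<chi> (x + int k * int n)"
      using \<chi> by (simp only: dirichlet_character_def)
    finally show ?case using Suc by simp
  qed simp
  obtain k where k: "b = a + int n * k"
    using ab by (auto simp: cong_iff_lin)
  show ?thesis
  proof (cases "k \<ge> 0")
    case True
    then show ?thesis using plus [of a "nat k"] k by (simp add: mult.commute)
  next
    case False
    \<comment> \<open>\<open>plus\<close> only moves forward, so for negative \<open>k\<close> the
      roles of \<open>a\<close> and \<open>b\<close> are exchanged.\<close>
    then have "a = b + int (nat (- k)) * int n" using k by (simp add: mult.commute)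
    then show ?thesis using plus [of b "nat (- k)"] by simp
  qed
qed

lemma dirichlet_character_mod:
  "dirichlet_character n \<chi> \<Longrightarrow> \<chi> (a mod int n) = \<chi> a"
  by (rule dirichlet_character_cong) auto

text \<open>For \<open>e dvd n\<close> this is equivalent to factoring through the units modulo
  \<open>e\<close>, but it mentions no auxiliary character and so is easier to combine for different
  moduli.\<close>

definition trivial_on_kernel :: "nat \<Rightarrow> (int \<Rightarrow> complex) \<Rightarrow> nat \<Rightarrow> bool" where
  "trivial_on_kernel n \<chi> e \<longleftrightarrow> (\<forall>a. coprime a (int n) \<longrightarrow> [a = 1] (mod int e) \<longrightarrow> \<chi> a = 1)"

text \<open>With \<open>c\<close> inverse to \<open>b\<close> modulo \<open>n\<close>, the product
  \<open>a * c\<close> lies in the kernel, so \<open>\<chi> (a * c) = 1 = \<chi> (b * c)\<close>,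
  and the nonzero \<open>\<chi> c\<close> cancels.\<close>

lemma trivial_on_kernel_cong:
  assumes \<chi>: "dirichlet_character n \<chi>" and e: "e dvd n" and tr: "trivial_on_kernel n \<chi> e"
    and a: "coprime a (int n)" and b: "coprime b (int n)" and ab: "[a = b] (mod int e)"
  shows "\<chi> a = \<chi> b"
proof -
  obtain c where c: "[b * c = 1] (mod int n)"
    using b cong_solve_coprime_int by blast
  have cc: "coprime c (int n)"
    using c by (metis cong_imp_coprime cong_sym coprime_1_left coprime_mult_left_iff)
  have bc: "[b * c = 1] (mod int e)"
    using c e cong_dvd_modulus by (metis of_nat_dvd_iff)
  have "[a * c = b * c] (mod int e)"
    using ab by (rule cong_scalar_right)
  then have "[a * c = 1] (mod int e)"
    using bc cong_trans by blast
  then have "\<chi> (a * c) = 1" using tr a cc by (simp add: trivial_on_kernel_def)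
  moreover have "\<chi> (b * c) = 1"
    using dirichlet_character_cong [OF \<chi> c] dirichlet_character_1 [OF \<chi>] by simp
  moreover have "\<chi> c \<noteq> 0" using dirichlet_character_eq_0_iff [OF \<chi>] cc by blast
  ultimately show ?thesis
    using dirichlet_character_mult [OF \<chi>] by (metis mult_right_cancel)
qed

text \<open>The character modulo \<open>e\<close> is found by evaluating \<open>\<chi>\<close> at a
  lift coprime to \<open>n\<close>; triviality on the kernel makes the value independent of the
  lift. Conversely, \<open>\<psi> 1 = 1\<close> forces triviality.\<close>

lemma trivial_on_kernel_iff_factors:
  assumes n: "n > 0" and \<chi>: "dirichlet_character n \<chi>" and e: "e dvd n"
  shows "trivial_on_kernel n \<chi> e \<longleftrightarrow>
    (\<exists>\<psi>. dirichlet_character e \<psi> \<and> (\<forall>a. coprime a (int n) \<longrightarrow> \<chi> a = \<psi> a))"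
proof
  assume tr: "trivial_on_kernel n \<chi> e"
  define lift where "lift a = (SOME c. [c = a] (mod int e) \<and> coprime c (int n))" for a
  have lift: "[lift a = a] (mod int e) \<and> coprime (lift a) (int n)" if "coprime a (int e)" for a
    unfolding lift_def by (rule someI_ex) (use lift_unit [OF n that] in blast)
  define \<psi> where "\<psi> a = (if coprime a (int e) then \<chi> (lift a) else 0)" for a
  have \<psi>: "\<psi> a = \<chi> c" if "[c = a] (mod int e)" "coprime c (int n)" for a c
  proof -
    have "coprime c (int e)"
      using that(2) e by (metis coprime_divisors dvd_refl of_nat_dvd_iff)
    then have a: "coprime a (int e)" using that(1) by (metis cong_imp_coprime)
    then have "[lift a = c] (mod int e)" using lift [OF a] that(1) by (metis cong_sym cong_trans)
    then have "\<chi> (lift a) = \<chi> c"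
      using trivial_on_kernel_cong [OF \<chi> e tr] lift [OF a] that(2) by blast
    then show ?thesis using a by (simp add: \<psi>_def)
  qed
  have "dirichlet_character e \<psi>"
    unfolding dirichlet_character_def
  proof (intro conjI allI)
    fix a
    show "\<psi> (a + int e) = \<psi> a"
    proof (cases "coprime a (int e)")
      case True
      have "[lift a = a + int e] (mod int e)"
        using lift [OF True] by (simp add: cong_def)
      then show ?thesis using \<psi> lift [OF True] by metis
    next
      case False
      then have "\<not> coprime (a + int e) (int e)"
        by (metis coprime_iff_gcd_eq_1 gcd_add1)
      then show ?thesis using False by (simp add: \<psi>_def)
    qed
    show "\<psi> a \<noteq> 0 \<longleftrightarrow> coprime a (int e)"
      using lift [of a] dirichlet_character_eq_0_iff [OF \<chi>] by (auto simp: \<psi>_def)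
  next
    fix a b
    show "\<psi> (a * b) = \<psi> a * \<psi> b"
    proof (cases "coprime a (int e) \<and> coprime b (int e)")
      case True
      then have la: "[lift a = a] (mod int e)" "coprime (lift a) (int n)"
        and lb: "[lift b = b] (mod int e)" "coprime (lift b) (int n)"
        using lift by blast+
      have "\<psi> (a * b) = \<chi> (lift a * lift b)"
        using la lb by (intro \<psi> cong_mult) simp_all
      then show ?thesis using True by (simp add: \<psi>_def dirichlet_character_mult [OF \<chi>])
    qed (auto simp: \<psi>_def)
  qed
  then show "\<exists>\<psi>. dirichlet_character e \<psi> \<and> (\<forall>a. coprime a (int n) \<longrightarrow> \<chi> a = \<psi> a)"
    using \<psi> cong_refl by metis
next
  assume "\<exists>\<psi>. dirichlet_character e \<psi> \<and> (\<forall>a. coprime a (int n) \<longrightarrow> \<chi> a = \<psi> a)"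
  then show "trivial_on_kernel n \<chi> e"
    unfolding trivial_on_kernel_def
    by (metis dirichlet_character_1 dirichlet_character_cong)
qed

text \<open>The kernels of reduction modulo \<open>e\<close> and modulo \<open>f\<close> together generate the kernel of
  reduction modulo \<open>gcd e f\<close>, by the Chinese remainder theorem.\<close>

lemma trivial_on_kernel_gcd:
  assumes n: "n > 0" and \<chi>: "dirichlet_character n \<chi>"
    and e: "e dvd n" "trivial_on_kernel n \<chi> e" and f: "f dvd n" "trivial_on_kernel n \<chi> f"
  shows "trivial_on_kernel n \<chi> (gcd e f)"
  unfolding trivial_on_kernel_def
proof (intro allI impI)
  fix a assume a: "coprime a (int n)" "[a = 1] (mod int (gcd e f))"
  have "gcd (int e) (int f) dvd a - 1"
    using a(2) by (simp add: cong_iff_dvd_diff)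
  then obtain k where k: "a - 1 = gcd (int e) (int f) * k" by blast
  obtain u v where uv: "u * int e + v * int f = gcd (int e) (int f)"
    using bezout_int by blast
  \<comment> \<open>From the Bezout relation, \<open>b\<close> is congruent to \<open>1\<close>
    modulo \<open>e\<close> and to \<open>a\<close> modulo \<open>f\<close>.\<close>
  define b where "b = 1 + u * int e * k"
  have be: "[b = 1] (mod int e)" by (simp add: b_def cong_iff_dvd_diff)
  have "a - b = v * int f * k"
    using k unfolding b_def uv [symmetric] by (simp add: algebra_simps)
  then have bf: "[b = a] (mod int f)"
    by (metis cong_iff_dvd_diff cong_sym dvd_triv_right dvd_mult2)
  have "coprime a (int f)" using a(1) f(1) by (metis coprime_divisors dvd_refl of_nat_dvd_iff)
  then have "coprime b (int f)" using bf by (metis cong_imp_coprime cong_sym)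
  moreover have "coprime b (int e)" using be by (metis cong_imp_coprime cong_sym coprime_1_left)
  ultimately have "coprime b (int (e * f))" by simp
  \<comment> \<open>\<open>b\<close> may share a prime with \<open>n\<close>, so it is replaced by a
    unit \<open>c\<close> with the same residues modulo \<open>e\<close> and
    \<open>f\<close>.\<close>
  then obtain c where c: "[c = b] (mod int (e * f))" "coprime c (int n)"
    using lift_unit [OF n] by blast
  have ce: "[c = 1] (mod int e)" and cf: "[a = c] (mod int f)"
    using c(1) be bf
    by (metis cong_modulus_mult cong_sym cong_trans mult.commute of_nat_mult)+
  have "\<chi> a = \<chi> c" by (rule trivial_on_kernel_cong [OF \<chi> f a(1) c(2) cf])
  also have "\<chi> c = 1" using e(2) c(2) ce by (simp add: trivial_on_kernel_def)
  finally show "\<chi> a = 1" .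
qed

text \<open>The definition gives only the least qualifying divisor. Closure under \<open>gcd\<close>
  makes it divide every other one; conversely, a multiple of the conductor has a smaller
  kernel.\<close>

lemma conductor_dvd_iff:
  assumes n: "n > 0" and \<chi>: "dirichlet_character n \<chi>"
  shows conductor_dvd: "conductor n \<chi> dvd n"
    and trivial_on_kernel_iff: "e dvd n \<Longrightarrow> trivial_on_kernel n \<chi> e \<longleftrightarrow> conductor n \<chi> dvd e"
proof -
  define P where "P d \<longleftrightarrow> d dvd n \<and> trivial_on_kernel n \<chi> d" for d
  have eq: "conductor n \<chi> = (LEAST d. P d)"
    unfolding conductor_def P_def
    using trivial_on_kernel_iff_factors [OF n \<chi>] by (intro arg_cong [where f = Least]) (auto cong: conj_cong)
  have "P n"
    using trivial_on_kernel_iff_factors [OF n \<chi>, of n] \<chi> by (auto simp: P_def)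
  then have Pc: "P (conductor n \<chi>)" unfolding eq by (rule LeastI)
  then show cn: "conductor n \<chi> dvd n" by (simp add: P_def)
  assume e: "e dvd n"
  show "trivial_on_kernel n \<chi> e \<longleftrightarrow> conductor n \<chi> dvd e"
  proof
    assume "trivial_on_kernel n \<chi> e"
    then have "P (gcd (conductor n \<chi>) e)"
      using trivial_on_kernel_gcd [OF n \<chi>] Pc e by (auto simp: P_def intro: dvd_trans)
    then have "conductor n \<chi> \<le> gcd (conductor n \<chi>) e"
      unfolding eq by (rule Least_le)
    moreover have "conductor n \<chi> > 0" using cn n by (metis dvd_pos_nat)
    ultimately show "conductor n \<chi> dvd e"
      by (metis gcd_dvd1 gcd_dvd2 dvd_imp_le le_antisym)
  next
    assume "conductor n \<chi> dvd e"
    then have "[a = 1] (mod int e) \<Longrightarrow> [a = 1] (mod int (conductor n \<chi>))" for a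
      using cong_dvd_modulus by (metis of_nat_dvd_iff)
    then show "trivial_on_kernel n \<chi> e"
      using Pc by (auto simp: P_def trivial_on_kernel_def)
  qed
qed

text \<open>If \<open>\<chi>\<close> is trivial on the kernel, the sum counts its elements.
  Otherwise some \<open>u\<close> in the kernel has \<open>\<chi> u \<noteq> 1\<close>; translation
  by \<open>u\<close> permutes the kernel, so the sum equals \<open>\<chi> u\<close> times itself
  and vanishes.\<close>

lemma sum_dirichlet_character_kernel:
  assumes n: "n > 0" and \<chi>: "dirichlet_character n \<chi>" and e: "e dvd n"
  shows "(\<Sum>a \<in> {a \<in> unit_residues_mod n. [a = 1] (mod int e)}. \<chi> a) =
    (if conductor n \<chi> dvd e then of_nat (totient n) / of_nat (totient e) else 0)"
proof (cases "conductor n \<chi> dvd e")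
  case True
  then have "trivial_on_kernel n \<chi> e"
    using trivial_on_kernel_iff [OF n \<chi> e] by simp
  then have "(\<Sum>a \<in> {a \<in> unit_residues_mod n. [a = 1] (mod int e)}. \<chi> a) =
      of_nat (card {a \<in> unit_residues_mod n. [a = 1] (mod int e)})"
    by (subst sum.cong [OF refl, of _ _ "\<lambda>_. 1"])
      (auto simp: trivial_on_kernel_def unit_residues_mod_iff)
  moreover have "totient e \<noteq> 0" using n e by auto
  ultimately show ?thesis
    using True by (simp add: divide_simps flip: card_units_cong_1 [OF n e] of_nat_mult)
next
  case False
  then obtain u where u: "coprime u (int n)" "[u = 1] (mod int e)" "\<chi> u \<noteq> 1"
    using trivial_on_kernel_iff [OF n \<chi> e] by (auto simp: trivial_on_kernel_def)
  define K where "K = {a \<in> unit_residues_mod n. [a = 1] (mod int e)}"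
  have "K = {a \<in> unit_residues_mod n. [a = u * 1] (mod int e)}"
    using u(2) by (auto simp: K_def cong_def)
  then have "bij_betw (\<lambda>a. u * a mod int n) K K"
    using bij_betw_mult_unit [OF n e u(1), of 1] by (simp add: K_def)
  then have "(\<Sum>a\<in>K. \<chi> a) = (\<Sum>a\<in>K. \<chi> (u * a mod int n))"
    by (rule sum.reindex_bij_betw [symmetric])
  also have "\<dots> = \<chi> u * (\<Sum>a\<in>K. \<chi> a)"
    by (simp add: dirichlet_character_mod [OF \<chi>] dirichlet_character_mult [OF \<chi>] sum_distrib_left)
  finally have "(\<Sum>a\<in>K. \<chi> a) = 0" using u(3) by auto
  then show ?thesis using False by (simp add: K_def)
qed

section \<open>Divisor sums, multiplicativity and prime powers\<close>

lemma sum_divisors_mult_coprime: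
  fixes f :: "nat \<Rightarrow> 'a::comm_monoid_add"
  assumes "coprime a b"
  shows "(\<Sum>e | e dvd a * b. f e) = (\<Sum>x | x dvd a. \<Sum>y | y dvd b. f (x * y))"
proof -
  \<comment> \<open>These identities recover both factors from the product, making \<open>e\<close>
    correspond to the pair \<open>(gcd e a, gcd e b)\<close>.\<close>
  have gcds: "gcd (x * y) a = x" "gcd (x * y) b = y" if "x dvd a" "y dvd b" for x y
  proof -
    have "coprime a y" "coprime b x"
      using that assms by (metis coprime_commute coprime_divisors dvd_refl)+
    then show "gcd (x * y) a = x" "gcd (x * y) b = y"
      using that by (auto simp: gcd_mult_left_right_cancel gcd_mult_left_left_cancel gcd_nat.absorb1)
  qed
  have "(\<Sum>x | x dvd a. \<Sum>y | y dvd b. f (x * y)) =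
      (\<Sum>(x, y) \<in> {x. x dvd a} \<times> {y. y dvd b}. f (x * y))"
    by (rule sum.cartesian_product)
  also have "\<dots> = (\<Sum>e | e dvd a * b. f e)"
  proof (rule sum.reindex_bij_witness [where j = "\<lambda>(x, y). x * y" and i = "\<lambda>e. (gcd e a, gcd e b)"])
    fix e assume "e \<in> {e. e dvd a * b}"
    then obtain x y where "e = x * y" "x dvd a" "y dvd b"
      using division_decomp by blast
    then show "(case (gcd e a, gcd e b) of (x, y) \<Rightarrow> x * y) = e"
      by (simp add: gcds)
    show "(gcd e a, gcd e b) \<in> {x. x dvd a} \<times> {y. y dvd b}" by simp
  qed (auto simp: gcds mult_dvd_mono)
  finally show ?thesis ..
qed

lemma multiplicative_prod_prime_powers:
  fixes F :: "nat \<Rightarrow> 'a::comm_semiring_1"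
  assumes F1: "F 1 = 1" and Fm: "\<And>a b. a > 0 \<Longrightarrow> b > 0 \<Longrightarrow> coprime a b \<Longrightarrow> F (a * b) = F a * F b"
    and "N > 0"
  shows "F N = (\<Prod>p \<in> prime_factors N. F (p ^ multiplicity p N))"
proof -
  \<comment> \<open>Stated for any finite set of primes, so that induction can split off one prime
    at a time.\<close>
  have *: "F (\<Prod>p \<in> A. p ^ k p) = (\<Prod>p \<in> A. F (p ^ k p))"
    if "finite A" "\<And>p. p \<in> A \<Longrightarrow> prime p" for A and k :: "nat \<Rightarrow> nat"
    using that
  proof (induction A rule: finite_induct)
    case (insert q A)
    have "coprime (q ^ k q) (\<Prod>p \<in> A. p ^ k p)"
    proof (rule prod_coprime_right)
      fix p assume "p \<in> A"
      then have "coprime q p"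
        using insert by (metis insert_iff primes_coprime)
      then show "coprime (q ^ k q) (p ^ k p)" by simp
    qed
    moreover have "q ^ k q > 0" "(\<Prod>p \<in> A. p ^ k p) > 0"
      using insert.prems by (auto intro!: prod_pos simp: prime_gt_0_nat)
    ultimately show ?case
      using insert by (simp add: Fm)
  qed (use F1 in simp)
  have "F N = F (\<Prod>p \<in> prime_factors N. p ^ multiplicity p N)"
    using prime_factorization_nat [OF \<open>N > 0\<close>] by simp
  also have "\<dots> = (\<Prod>p \<in> prime_factors N. F (p ^ multiplicity p N))"
    by (rule *) auto
  finally show ?thesis .
qed

lemma sum_divisors_primepow:
  fixes p :: nat and f :: "nat \<Rightarrow> 'a::comm_monoid_add"
  assumes "prime p"
  shows "(\<Sum>e | e dvd p ^ m. f e) = (\<Sum>j\<le>m. f (p ^ j))"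
proof -
  have "{e. e dvd p ^ m} = (\<lambda>j. p ^ j) ` {..m}"
    using divides_primepow_nat [OF assms] by auto
  moreover have "inj_on (\<lambda>j. p ^ j) {..m}"
    using prime_gt_1_nat [OF assms] by (auto simp: inj_on_def)
  ultimately show ?thesis by (simp add: sum.reindex)
qed

lemma divisor_sigma_eq_sum_div:
  assumes "N > 0"
  shows "divisor_sigma k N = (\<Sum>e | e dvd N. (N div e) ^ k)"
  unfolding divisor_sigma_def
  by (rule sum.reindex_bij_witness [where i = "\<lambda>e. N div e" and j = "\<lambda>e. N div e"])
    (use assms in \<open>auto simp: div_div_eq_right\<close>)

text \<open>By Euler's product formula, \<open>totient N / N\<close> depends only on the set of
  primes dividing \<open>N\<close>.\<close>

lemma totient_ratio_same_prime_factors: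
  assumes "e > 0" "prime_factors e = prime_factors N"
  shows "of_nat (totient N) / of_nat (totient e) = (of_nat N / of_nat e :: 'a::field_char_0)"
proof -
  have "real (totient N) * real e = real (totient e) * real N"
    using assms(2) by (simp add: totient_formula2)
  then have "totient N * e = totient e * N"
    by (metis of_nat_eq_iff of_nat_mult)
  then have "(of_nat (totient N) * of_nat e :: 'a) = of_nat (totient e) * of_nat N"
    by (metis of_nat_mult)
  then show ?thesis using assms(1) by (simp add: divide_simps mult.commute)
qed

text \<open>The sum left by orthogonality on the part of \<open>n\<close> coprime to
  \<open>d\<close>, where divisibility by \<open>d\<close> imposes nothing; \<open>t\<close> stands
  for \<open>s - 1\<close>.\<close>

definition ratio_sum :: "nat \<Rightarrow> nat \<Rightarrow> nat \<Rightarrow> complex" where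
  "ratio_sum r t N =
     (\<Sum>e | e dvd N. (of_nat N / of_nat e) ^ r * (of_nat (totient N) / of_nat (totient e)) ^ t)"

lemma ratio_sum_mult_coprime:
  assumes "coprime a b" "a > 0" "b > 0"
  shows "ratio_sum r t (a * b) = ratio_sum r t a * ratio_sum r t b"
proof -
  have "totient (x * y) = totient x * totient y" if "x dvd a" "y dvd b" for x y
    using that assms(1) by (intro totient_mult_coprime) (metis coprime_divisors)
  then show ?thesis
    unfolding ratio_sum_def
    by (simp add: sum_divisors_mult_coprime [OF assms(1)] sum_product
        power_mult_distrib power_divide mult_ac)
qed

text \<open>The divisor \<open>1\<close> gives the first summand. Each \<open>p ^ j\<close> with
  \<open>j \<ge> 1\<close> has the same prime as \<open>p ^ m\<close>, so both ratios are
  \<open>p ^ (m - j)\<close>; these terms form the divisor sigma without its top term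
  \<open>p ^ (m * (t + r))\<close>.\<close>

lemma ratio_sum_primepow:
  assumes p: "prime p" and m: "m > 0"
  shows "ratio_sum r t (p ^ m) = of_nat (totient (p ^ m)) ^ t * of_nat p ^ (m * r)
    + of_nat (divisor_sigma (t + r) (p ^ m)) - of_nat p ^ (m * (t + r))"
proof -
  let ?g = "\<lambda>e. (of_nat (p ^ m) / of_nat e) ^ r *
              (of_nat (totient (p ^ m)) / of_nat (totient e)) ^ t :: complex"
  have p0: "p > 0" using p by (simp add: prime_gt_0_nat)
  have split: "{..m} = insert 0 {1..m}" by auto
  have "ratio_sum r t (p ^ m) = ?g 1 + (\<Sum>j=1..m. ?g (p ^ j))"
    by (simp add: ratio_sum_def sum_divisors_primepow [OF p] split)
  also have "(\<Sum>j=1..m. ?g (p ^ j)) = (\<Sum>j=1..m. of_nat ((p ^ m div p ^ j) ^ (t + r)))"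
  proof (rule sum.cong [OF refl])
    fix j assume j: "j \<in> {1..m}"
    have "prime_factors (p ^ j) = prime_factors (p ^ m)"
      using j m p by (simp add: prime_factorization_prime_power)
    then have "(of_nat (totient (p ^ m)) / of_nat (totient (p ^ j)) :: complex) = of_nat (p ^ m) / of_nat (p ^ j)"
      using p0 by (intro totient_ratio_same_prime_factors) auto
    moreover have "(of_nat (p ^ m) / of_nat (p ^ j) :: complex) = of_nat (p ^ m div p ^ j)"
      using j by (intro of_nat_of_nat_div [symmetric] le_imp_power_dvd) simp
    ultimately show "?g (p ^ j) = of_nat ((p ^ m div p ^ j) ^ (t + r))"
      by (simp add: power_add)
  qed
  also have "\<dots> = of_nat (divisor_sigma (t + r) (p ^ m)) - of_nat p ^ (m * (t + r))"
    using p0 by (simp add: divisor_sigma_eq_sum_div sum_divisors_primepow [OF p] split power_mult)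
  finally show ?thesis by (simp add: power_mult)
qed

lemma ratio_sum_prod:
  assumes "N > 0"
  shows "ratio_sum r t N = (\<Prod>p \<in> prime_factors N. let m = multiplicity p N in
            of_nat (totient (p ^ m)) ^ t * of_nat p ^ (m * r)
            + of_nat (divisor_sigma (t + r) (p ^ m)) - of_nat p ^ (m * (t + r)))"
proof -
  have "ratio_sum r t N = (\<Prod>p \<in> prime_factors N. ratio_sum r t (p ^ multiplicity p N))"
    by (rule multiplicative_prod_prime_powers)
      (simp_all add: assms ratio_sum_mult_coprime, simp add: ratio_sum_def)
  also have "\<dots> = (\<Prod>p \<in> prime_factors N. let m = multiplicity p N in
            of_nat (totient (p ^ m)) ^ t * of_nat p ^ (m * r)
            + of_nat (divisor_sigma (t + r) (p ^ m)) - of_nat p ^ (m * (t + r)))"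
    by (rule prod.cong) (auto simp: Let_def ratio_sum_primepow prime_factors_multiplicity)
  finally show ?thesis .
qed

text \<open>Any \<open>e\<close> between \<open>d\<close> and \<open>N\<close> in the divisibility
  order has their common prime factors, so both ratios equal \<open>N / e\<close>, and
  \<open>N div e\<close> runs through the divisors of \<open>N div d\<close>.\<close>

lemma sum_divisors_above:
  assumes N: "N > 0" and d: "d dvd N" and pf: "prime_factors N = prime_factors d"
  shows "(\<Sum>e | e dvd N \<and> d dvd e. (of_nat N / of_nat e) ^ r *
            (of_nat (totient N) / of_nat (totient e)) ^ t) =
         (of_nat (divisor_sigma (t + r) (N div d)) :: complex)"
proof -
  have "(\<Sum>e | e dvd N \<and> d dvd e. (of_nat N / of_nat e) ^ r *
            (of_nat (totient N) / of_nat (totient e)) ^ t) =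
        (\<Sum>x | x dvd N div d. (of_nat (x ^ (t + r)) :: complex))"
  proof (rule sum.reindex_bij_witness [where i = "\<lambda>x. N div x" and j = "\<lambda>e. N div e"])
    fix e assume "e \<in> {e. e dvd N \<and> d dvd e}"
    then have e: "e dvd N" "d dvd e" by auto
    then obtain k l where k: "N = e * k" and l: "e = d * l" by (auto elim!: dvdE)
    have pos: "e > 0" "d > 0" "k > 0" using N k l by auto
    have "prime_factors d \<subseteq> prime_factors e" "prime_factors e \<subseteq> prime_factors N"
      using e N pos by (simp_all add: dvd_prime_factors)
    then have "prime_factors e = prime_factors N" using pf by auto
    then have "(of_nat (totient N) / of_nat (totient e) :: complex) = of_nat N / of_nat e"
      using pos by (intro totient_ratio_same_prime_factors)
    moreover have "(of_nat N / of_nat e :: complex) = of_nat (N div e)"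
      using e(1) by (rule of_nat_of_nat_div [symmetric])
    ultimately show "of_nat ((N div e) ^ (t + r)) = (of_nat N / of_nat e) ^ r *
            (of_nat (totient N) / of_nat (totient e) :: complex) ^ t"
      by (simp add: power_add)
    show "N div (N div e) = e" using pos k by simp
    show "N div e \<in> {x. x dvd N div d}" using pos k l by simp
  next
    fix x assume "x \<in> {x. x dvd N div d}"
    then obtain k where "N div d = x * k" by auto
    then have k: "N = d * x * k" using d by (metis dvd_mult_div_cancel mult.assoc)
    have pos: "x > 0" "d > 0" "k > 0" using N k by auto
    have "N div x = d * k" using k pos by simp
    then show "N div (N div x) = x" "N div x \<in> {e. e dvd N \<and> d dvd e}"
      using k pos by auto
  qed
  then show ?thesis by (simp add: divisor_sigma_def)
qed

section \<open>Expansion of the gcd and separation of the variables\<close>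

lemma card_residues_mod_dvd:
  assumes n: "n > 0" and e: "e dvd n"
  shows "card {b \<in> residues_mod n. int e dvd b} = n div e"
proof -
  have e0: "e > 0" using assms by (metis dvd_pos_nat)
  obtain k where k: "n = e * k" using e by blast
  have "{b \<in> residues_mod n. int e dvd b} = (\<lambda>i. int e * i) ` {0..<int k}"
    using e0 by (auto simp: residues_mod_def k zero_le_mult_iff elim!: dvdE)
  moreover have "inj_on (\<lambda>i. int e * i) {0..<int k}" using e0 by (simp add: inj_on_def)
  ultimately show ?thesis using k e0 by (simp add: card_image)
qed

text \<open>Gauss's totient identity for the gcd. As \<open>n\<close> lies in \<open>X\<close>, the
  range can be enlarged to the divisors of \<open>n\<close>, which do not depend on
  \<open>X\<close>, so that summations can be exchanged.\<close>

lemma of_int_Gcd_eq_totient_sum: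
  fixes X :: "int set"
  assumes n: "n > 0" and X: "int n \<in> X"
  shows "(of_int (Gcd X) :: complex) =
    (\<Sum>e | e dvd n. of_nat (totient e) * (if \<forall>x\<in>X. int e dvd x then 1 else 0))"
proof -
  define g where "g = nat (Gcd X)"
  have g: "Gcd X = int g" unfolding g_def
    by (metis Gcd_int_greater_eq_0 int_nat_eq)
  have dvd: "e dvd g \<longleftrightarrow> (\<forall>x\<in>X. int e dvd x)" for e
    by (metis dvd_Gcd_iff g of_nat_dvd_iff)
  then have gn: "e dvd g \<Longrightarrow> e dvd n" for e using X by (metis of_nat_dvd_iff)
  have "(of_int (Gcd X) :: complex) = of_nat (\<Sum>e | e dvd g. totient e)"
    by (simp add: g totient_divisor_sum)
  \<comment> \<open>The condition holds throughout this range; it is inserted to make the terms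
    added next vanish.\<close>
  also have "\<dots> = (\<Sum>e | e dvd g. of_nat (totient e) * (if e dvd g then 1 else 0))"
    by simp
  also have "\<dots> = (\<Sum>e | e dvd n. of_nat (totient e) * (if e dvd g then 1 else 0))"
    using n gn by (intro sum.mono_neutral_left) auto
  finally show ?thesis by (simp add: dvd)
qed

lemma gcd_character_sum_divisors:
  fixes r s n :: nat and \<chi> :: "nat \<Rightarrow> int \<Rightarrow> complex"
  assumes n: "n > 0" and s: "s > 0"
    and \<chi>: "\<And>i. i < s \<Longrightarrow> dirichlet_character n (\<chi> i)"
  shows "(\<Sum>a \<in> {..<s} \<rightarrow>\<^sub>E unit_residues_mod n. \<Sum>b \<in> {..<r} \<rightarrow>\<^sub>E residues_mod n.
            of_int (Gcd ((\<lambda>i. a i - 1) ` {..<s} \<union> b ` {..<r} \<union> {int n})) * (\<Prod>i<s. \<chi> i (a i)))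
       = of_nat (totient n) * (\<Sum>e | e dvd n \<and> (LCM i\<in>{..<s}. conductor n (\<chi> i)) dvd e.
            (of_nat n / of_nat e) ^ r * (of_nat (totient n) / of_nat (totient e)) ^ (s - 1))"
proof -
  let ?A = "{..<s} \<rightarrow>\<^sub>E unit_residues_mod n" and ?B = "{..<r} \<rightarrow>\<^sub>E residues_mod n"
  let ?d = "LCM i\<in>{..<s}. conductor n (\<chi> i)"
  define f where "f e i a = (if int e dvd a - 1 then \<chi> i a else 0)" for e i a
  define h where "h e b = (if int e dvd b then 1 else 0 :: complex)" for e :: nat and b :: int
  have fin: "finite {e. e dvd n}" using n by simp
  have finr: "finite (residues_mod n)" by (simp add: residues_mod_def)
  \<comment> \<open>The joint divisibility condition splits into one condition per variable; the
    entry \<open>n\<close> satisfies it because \<open>e dvd n\<close>.\<close>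
  have indicator: "(if \<forall>x \<in> (\<lambda>i. a i - 1) ` {..<s} \<union> b ` {..<r} \<union> {int n}. int e dvd x then 1 else 0) *
      (\<Prod>i<s. \<chi> i (a i)) = (\<Prod>i<s. f e i (a i)) * (\<Prod>i<r. h e (b i))"
    if "e dvd n" for e and a b :: "nat \<Rightarrow> int"
  proof -
    consider "\<forall>i<s. int e dvd a i - 1" "\<forall>i<r. int e dvd b i"
      | i where "i < s" "\<not> int e dvd a i - 1" | i where "i < r" "\<not> int e dvd b i"
      by blast
    then show ?thesis
    proof cases
      case 1
      then have "\<forall>x \<in> (\<lambda>i. a i - 1) ` {..<s} \<union> b ` {..<r} \<union> {int n}. int e dvd x"
        using that by auto
      then show ?thesis using 1 by (simp add: f_def h_def)
    next
      case 2
      then have "(\<Prod>i<s. f e i (a i)) = 0" by (intro prod_zero) (auto simp: f_def)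
      moreover have "\<not> (\<forall>x \<in> (\<lambda>i. a i - 1) ` {..<s} \<union> b ` {..<r} \<union> {int n}. int e dvd x)"
        using 2 by blast
      ultimately show ?thesis by (simp only: if_False mult_zero_left)
    next
      case 3
      then have "(\<Prod>i<r. h e (b i)) = 0" by (intro prod_zero) (auto simp: h_def)
      moreover have "\<not> (\<forall>x \<in> (\<lambda>i. a i - 1) ` {..<s} \<union> b ` {..<r} \<union> {int n}. int e dvd x)"
        using 3 by blast
      ultimately show ?thesis by (simp only: if_False mult_zero_left mult_zero_right)
    qed
  qed
  have sumf: "(\<Sum>a \<in> unit_residues_mod n. f e i a) =
      (if conductor n (\<chi> i) dvd e then of_nat (totient n) / of_nat (totient e) else 0)"
    if "e dvd n" "i < s" for e i
    using sum_dirichlet_character_kernel [OF n \<chi> that(1), of i] that(2)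
    by (simp add: f_def cong_iff_dvd_diff sum.inter_filter)
  have sumh: "(\<Sum>b \<in> residues_mod n. h e b) = of_nat n / of_nat e" if "e dvd n" for e
  proof -
    have "(\<Sum>b \<in> residues_mod n. h e b) = of_nat (n div e)"
      using card_residues_mod_dvd [OF n that] finr by (simp add: h_def flip: sum.inter_filter)
    then show ?thesis using that by (metis of_nat_of_nat_div)
  qed
  have "(\<Sum>a \<in> ?A. \<Sum>b \<in> ?B.
            of_int (Gcd ((\<lambda>i. a i - 1) ` {..<s} \<union> b ` {..<r} \<union> {int n})) * (\<Prod>i<s. \<chi> i (a i)))
      = (\<Sum>a \<in> ?A. \<Sum>b \<in> ?B. \<Sum>e | e dvd n.
          of_nat (totient e) * ((\<Prod>i<s. f e i (a i)) * (\<Prod>i<r. h e (b i))))"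
  proof (intro sum.cong refl)
    fix a b :: "nat \<Rightarrow> int"
    let ?X = "(\<lambda>i. a i - 1) ` {..<s} \<union> b ` {..<r} \<union> {int n}"
    have "of_int (Gcd ?X) * (\<Prod>i<s. \<chi> i (a i)) = (\<Sum>e | e dvd n. of_nat (totient e) *
        ((if \<forall>x\<in>?X. int e dvd x then 1 else 0) * (\<Prod>i<s. \<chi> i (a i))))"
      by (subst of_int_Gcd_eq_totient_sum [OF n]) (simp_all add: sum_distrib_right mult.assoc)
    also have "\<dots> = (\<Sum>e | e dvd n.
          of_nat (totient e) * ((\<Prod>i<s. f e i (a i)) * (\<Prod>i<r. h e (b i))))"
      by (intro sum.cong refl) (simp only: mem_Collect_eq indicator)
    finally show "of_int (Gcd ?X) * (\<Prod>i<s. \<chi> i (a i)) = \<dots>" .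
  qed
  also have "\<dots> = (\<Sum>a \<in> ?A. \<Sum>e | e dvd n. \<Sum>b \<in> ?B.
          of_nat (totient e) * ((\<Prod>i<s. f e i (a i)) * (\<Prod>i<r. h e (b i))))"
    by (intro sum.cong refl sum.swap)
  also have "\<dots> = (\<Sum>e | e dvd n. \<Sum>a \<in> ?A. \<Sum>b \<in> ?B.
          of_nat (totient e) * ((\<Prod>i<s. f e i (a i)) * (\<Prod>i<r. h e (b i))))"
    by (rule sum.swap)
  also have "\<dots> = (\<Sum>e | e dvd n. of_nat (totient e) *
      ((\<Sum>a \<in> ?A. \<Prod>i<s. f e i (a i)) * (\<Sum>b \<in> ?B. \<Prod>i<r. h e (b i))))"
    by (simp only: sum_product) (simp only: sum_distrib_left)
  also have "\<dots> = (\<Sum>e | e dvd n. of_nat (totient e) *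
      ((\<Prod>i<s. \<Sum>a \<in> unit_residues_mod n. f e i a) * (\<Prod>i<r. \<Sum>b \<in> residues_mod n. h e b)))"
    by (intro sum.cong refl) (simp only: prod_sum_PiE finite_lessThan finite_unit_residues_mod finr)
  also have "\<dots> = (\<Sum>e | e dvd n. if ?d dvd e then of_nat (totient n) *
      ((of_nat n / of_nat e) ^ r * (of_nat (totient n) / of_nat (totient e)) ^ (s - 1)) else 0)"
  proof (intro sum.cong refl)
    fix e assume "e \<in> {e. e dvd n}"
    then have e: "e dvd n" by simp
    have te: "totient e \<noteq> 0" using e n by auto
    \<comment> \<open>All \<open>s\<close> factors are nonzero exactly when every conductor, hence
      their lcm, divides \<open>e\<close>.\<close>
    have prodf: "(\<Prod>i<s. \<Sum>a \<in> unit_residues_mod n. f e i a) =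
        (if ?d dvd e then (of_nat (totient n) / of_nat (totient e)) ^ s else 0)"
    proof (cases "?d dvd e")
      case True
      then have "i < s \<Longrightarrow> conductor n (\<chi> i) dvd e" for i
        by (auto simp: Lcm_dvd_iff)
      then show ?thesis using True by (simp add: sumf [OF e])
    next
      case False
      then obtain i where "i < s" "\<not> conductor n (\<chi> i) dvd e"
        by (auto simp: Lcm_dvd_iff)
      then show ?thesis using False sumf [OF e, of i] by auto
    qed
    \<comment> \<open>One of the \<open>s\<close> factors absorbs \<open>totient e\<close> and
      leaves \<open>totient n\<close>; hence the exponent \<open>s - 1\<close>.\<close>
    obtain t where t: "s = Suc t" using s by (cases s) auto
    show "of_nat (totient e) * ((\<Prod>i<s. \<Sum>a \<in> unit_residues_mod n. f e i a) *
        (\<Prod>i<r. \<Sum>b \<in> residues_mod n. h e b)) = (if ?d dvd e then of_nat (totient n) *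
      ((of_nat n / of_nat e) ^ r * (of_nat (totient n) / of_nat (totient e)) ^ (s - 1)) else 0)"
      unfolding prodf sumh [OF e] using te by (simp add: t)
  qed
  also have "\<dots> = (\<Sum>e | e dvd n \<and> ?d dvd e. of_nat (totient n) *
      ((of_nat n / of_nat e) ^ r * (of_nat (totient n) / of_nat (totient e)) ^ (s - 1)))"
    using fin by (simp add: sum.inter_filter [symmetric])
  finally show ?thesis by (simp only: sum_distrib_left)
qed

section \<open>The divisor \<open>n\<^sub>0\<close> and the final factorization\<close>

lemma not_coprime_imp_common_prime:
  fixes a b :: nat
  assumes "\<not> coprime a b"
  obtains p where "prime p" "p dvd a" "p dvd b"
proof -
  have "gcd a b \<noteq> 1" using assms unfolding coprime_iff_gcd_eq_1 .
  then obtain p where "prime p" "p dvd gcd a b" using prime_factor_nat by blast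
  then show thesis using that by simp
qed

text \<open>Maximality forces \<open>n\<^sub>0\<close> to contain the full power of each of its primes.\<close>

lemma maximal_same_prime_factors:
  fixes n d n\<^sub>0 :: nat
  assumes n: "n > 0" and d: "d dvd n"
    and n0: "n\<^sub>0 = Max {m. m dvd n \<and> prime_factors m = prime_factors d}"
  shows "n\<^sub>0 dvd n" "prime_factors n\<^sub>0 = prime_factors d" "coprime n\<^sub>0 (n div n\<^sub>0)" "d dvd n\<^sub>0"
proof -
  let ?S = "{m. m dvd n \<and> prime_factors m = prime_factors d}"
  have fin: "finite ?S" using n by (auto intro: finite_subset [of _ "{m. m dvd n}"])
  have "n\<^sub>0 \<in> ?S" unfolding n0 using d by (intro Max_in [OF fin]) auto
  then show dvd: "n\<^sub>0 dvd n" and pf: "prime_factors n\<^sub>0 = prime_factors d" by auto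
  have n0_pos: "n\<^sub>0 > 0" and d_pos: "d > 0"
    using dvd_pos_nat [OF n dvd] dvd_pos_nat [OF n d] .
  show cop: "coprime n\<^sub>0 (n div n\<^sub>0)"
  proof (rule ccontr)
    assume "\<not> coprime n\<^sub>0 (n div n\<^sub>0)"
    then obtain p where p: "prime p" "p dvd n\<^sub>0" "p dvd n div n\<^sub>0"
      by (rule not_coprime_imp_common_prime)
    \<comment> \<open>\<open>n\<^sub>0 * p\<close> would be a larger candidate, as multiplying by
      \<open>p\<close> adds no new prime.\<close>
    have "n\<^sub>0 * p dvd n\<^sub>0 * (n div n\<^sub>0)" using p(3) by (rule mult_dvd_mono [OF dvd_refl])
    then have "n\<^sub>0 * p dvd n" using dvd by simp
    moreover have "prime_factors (n\<^sub>0 * p) = prime_factors n\<^sub>0"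
    proof -
      have "prime_factors (n\<^sub>0 * p) = prime_factors n\<^sub>0 \<union> {p}"
        using n0_pos p(1) prime_gt_0_nat [OF p(1)]
        by (simp add: prime_factorization_mult prime_factorization_prime)
      moreover have "p \<in> prime_factors n\<^sub>0"
        using n0_pos p(1,2) by (simp add: in_prime_factors_iff)
      ultimately show ?thesis by blast
    qed
    ultimately have "n\<^sub>0 * p \<in> ?S" unfolding pf by simp
    then have "n\<^sub>0 * p \<le> n\<^sub>0" by (rule Max_ge [OF fin, folded n0])
    then show False using prime_gt_1_nat [OF p(1)] n0_pos by simp
  qed
  \<comment> \<open>The primes of \<open>d\<close> are those of \<open>n\<^sub>0\<close>, so
    \<open>d\<close> shares none with the cofactor and must divide \<open>n\<^sub>0\<close>.\<close>
  have "coprime d (n div n\<^sub>0)"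
  proof (rule ccontr)
    assume "\<not> coprime d (n div n\<^sub>0)"
    then obtain p where p: "prime p" "p dvd d" "p dvd n div n\<^sub>0"
      by (rule not_coprime_imp_common_prime)
    then have "p \<in> prime_factors d" using d_pos by (simp add: in_prime_factors_iff)
    then have "p \<in> prime_factors n\<^sub>0" unfolding pf .
    then have "p dvd n\<^sub>0" by auto
    then show False using cop p by (metis coprime_common_divisor not_prime_unit)
  qed
  moreover have "d dvd n\<^sub>0 * (n div n\<^sub>0)" using d dvd by simp
  ultimately show "d dvd n\<^sub>0" by (simp add: coprime_dvd_mult_left_iff)
qed

theorem theorem3p2:
  fixes r s n d n\<^sub>0 :: nat and \<chi> :: "nat \<Rightarrow> int \<Rightarrow> complex"
  assumes "s > 0" and "n > 0"
    and "\<And>i. i < s \<Longrightarrow> dirichlet_character n (\<chi> i)"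
    and "d = (LCM i\<in>{..<s}. conductor n (\<chi> i))"
    and "n\<^sub>0 = Max {m. m dvd n \<and> prime_factors m = prime_factors d}"
  shows "(\<Sum>a \<in> {..<s} \<rightarrow>\<^sub>E unit_residues_mod n. \<Sum>b \<in> {..<r} \<rightarrow>\<^sub>E residues_mod n.
            of_int (Gcd ((\<lambda>i. a i - 1) ` {..<s} \<union> b ` {..<r} \<union> {int n})) * (\<Prod>i<s. \<chi> i (a i)))
       = of_nat (totient n) * of_nat (divisor_sigma (s + r - 1) (n\<^sub>0 div d)) *
         (\<Prod>p \<in> prime_factors (n div n\<^sub>0). let m = multiplicity p (n div n\<^sub>0) in
            of_nat (totient (p ^ m)) ^ (s - 1) * of_nat p ^ (m * r)
            + of_nat (divisor_sigma (s + r - 1) (p ^ m)) - of_nat p ^ (m * (s + r - 1)))"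
proof -
  have "d dvd n"
    unfolding assms(4) using conductor_dvd [OF assms(2,3)] by (auto simp: Lcm_dvd_iff)
  note n0 = maximal_same_prime_factors [OF assms(2) this assms(5)]
  define n1 where "n1 = n div n\<^sub>0"
  have n: "n = n\<^sub>0 * n1" using n0(1) by (simp add: n1_def)
  have pos: "n\<^sub>0 > 0" "n1 > 0" using assms(2) n by auto
  have cop: "coprime n\<^sub>0 n1" using n0(3) by (simp add: n1_def)
  let ?t = "s - 1"
  let ?g = "\<lambda>N e. (of_nat N / of_nat e) ^ r * (of_nat (totient N) / of_nat (totient e)) ^ ?t :: complex"
  have finn: "finite {e. e dvd n}" "finite {e. e dvd n\<^sub>0}" using assms(2) pos by simp_all
  \<comment> \<open>Writing \<open>e = x * y\<close> splits the summand, while the condition on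
    \<open>d\<close> concerns \<open>x\<close> alone because \<open>d\<close> is coprime to
    \<open>y\<close>.\<close>
  have g_mult: "?g n (x * y) = ?g n\<^sub>0 x * ?g n1 y" and d_iff: "d dvd x * y \<longleftrightarrow> d dvd x"
    if "x dvd n\<^sub>0" "y dvd n1" for x y
  proof -
    have "coprime x y" using that cop by (metis coprime_divisors)
    then have "(of_nat (totient n) / of_nat (totient (x * y)) :: complex) =
        (of_nat (totient n\<^sub>0) / of_nat (totient x)) * (of_nat (totient n1) / of_nat (totient y))"
      unfolding n totient_mult_coprime [OF cop] by (simp add: totient_mult_coprime)
    moreover have "(of_nat n / of_nat (x * y) :: complex) = (of_nat n\<^sub>0 / of_nat x) * (of_nat n1 / of_nat y)"
      unfolding n by simp
    ultimately show "?g n (x * y) = ?g n\<^sub>0 x * ?g n1 y"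
      by (simp only: power_mult_distrib mult.assoc mult.left_commute)
    have "coprime d y" using that n0(4) cop by (metis coprime_divisors)
    then show "d dvd x * y \<longleftrightarrow> d dvd x" by (simp add: coprime_dvd_mult_left_iff)
  qed
  have "(\<Sum>e | e dvd n \<and> d dvd e. ?g n e) = (\<Sum>e | e dvd n. if d dvd e then ?g n e else 0)"
    using finn(1) by (simp add: sum.inter_filter [symmetric])
  also have "\<dots> = (\<Sum>x | x dvd n\<^sub>0. \<Sum>y | y dvd n1. (if d dvd x * y then ?g n (x * y) else 0))"
    by (subst (1) n, rule sum_divisors_mult_coprime [OF cop])
  also have "\<dots> = (\<Sum>x | x dvd n\<^sub>0. \<Sum>y | y dvd n1. (if d dvd x then ?g n\<^sub>0 x else 0) * ?g n1 y)"
    by (intro sum.cong refl) (simp only: mem_Collect_eq g_mult d_iff, simp)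
  also have "\<dots> = (\<Sum>x | x dvd n\<^sub>0. if d dvd x then ?g n\<^sub>0 x else 0) * ratio_sum r ?t n1"
    by (simp add: ratio_sum_def sum_product)
  also have "(\<Sum>x | x dvd n\<^sub>0. if d dvd x then ?g n\<^sub>0 x else 0) = (\<Sum>x | x dvd n\<^sub>0 \<and> d dvd x. ?g n\<^sub>0 x)"
    using finn(2) by (simp add: sum.inter_filter [symmetric])
  also have "\<dots> = of_nat (divisor_sigma (?t + r) (n\<^sub>0 div d))"
    by (rule sum_divisors_above [OF pos(1) n0(4,2)])
  finally have *: "(\<Sum>e | e dvd n \<and> d dvd e. ?g n e) =
    of_nat (divisor_sigma (?t + r) (n\<^sub>0 div d)) * ratio_sum r ?t n1" .
  \<comment> \<open>Truncated subtraction is harmless here because \<open>s > 0\<close>.\<close>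
  have exponent: "?t + r = s + r - 1" using assms(1) by simp
  show ?thesis
    by (subst gcd_character_sum_divisors)
      (use assms(1-3) in \<open>simp_all only: assms(4) [symmetric] *
        n1_def ratio_sum_prod [OF pos(2), unfolded n1_def] exponent mult.assoc\<close>)
qed

end
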